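(* For all regexes $R\in\mathcal{R}$ and all valid locations $x$ and $y$: (1) $\mathit{Null}_x(R)\iff\mathit{Null}_{x^r}(R^r)$; (2) $x\xrightarrow{R}y\iff y^r\xrightarrow{R^r}x^r$.
   Context: **Alphabet.** $\Sigma$ is a domain of characters, and $(\Sigma,\Psi,[\![\cdot]\!],\bot,\top,\vee,\wedge,\neg)$ is an effective Boolean algebra over $\Sigma$: $\Psi$ is a set of predicates closed under the connectives, $[\![\cdot]\!]:\Psi\to 2^\Sigma$, $[\![\bot]\!]=\emptyset$, $[\![\top]\!]=\Sigma$, $[\![\varphi\vee\psi]\!]=[\![\varphi]\!]\cup[\![\psi]\!]$, $[\![\varphi\wedge\psi]\!]=[\![\varphi]\!]\cap[\![\psi]\!]$, $[\![\neg\varphi]\!]=\Sigma\setminus[\![\varphi]\!]$. **Strings and locations.** For $s\in\Sigma^*$, $|s|$ is its length, $s_i$ ($0\le i<|s|$) its $i$-th character (indexing from 0), and $s_{-1}=s_{|s|}=\epsilon$ (the empty string, which belongs to no $[\![\psi]\!]$). $s^r$ is the reverse of $s$. A location in $s$ is a pair $s\langle i\rangle=\langle s,i\rangle$ with $-1\le i\le|s|$; it is valid if $0\le i\le|s|$ and final if $i=|s|$. Locations are ordered by position: $s\langle i\rangle<s\langle j\rangle$ iff $i<j$; $s\langle i\rangle+1=s\langle i+1\rangle$. The reverse of a valid location is $s\langle i\rangle^r=s^r\langle|s|-i\rangle$. The match failure is $\mathsf{fail}=\epsilon\langle-1\rangle$, and $\max(x,\mathsf{fail})=\max(\mathsf{fail},x)=x$.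 **Regexes.** $\mathcal{R}$ is generated by $$R::=\psi\mid()\mid R\,\mathtt{|}\,R'\mid R\,\mathtt{\&}\,R'\mid R\cdot R'\mid R\{m,n\}\mid\ \sim R\mid\mathtt{(?=}R\mathtt{)}\mid\mathtt{(?<=}R\mathtt{)}\mid\mathtt{(?!}R\mathtt{)}\mid\mathtt{(?<!}R\mathtt{)}$$ with $\psi\in\Psi$ and loop bounds $m,n$ satisfying $0\le m\le n\ne0$ with $n$ finite, or $m\geq 0$ finite and $n=\infty$. Convention: $R\{0,0\}=()$. The last four forms (lookahead, lookback, negative lookahead, negative lookback) are called lookarounds. **Reverse of regexes.** $\psi^r=\psi$, $()^r=()$, $(R|S)^r=R^r|S^r$, $(R\&S)^r=R^r\&S^r$, $(R\cdot S)^r=S^r\cdot R^r$, $(R\{m,n\})^r=R^r\{m,n\}$, $(\sim R)^r=\sim(R^r)$, $\mathtt{(?=}R\mathtt{)}^r=\mathtt{(?<=}R^r\mathtt{)}$, $\mathtt{(?<=}R\mathtt{)}^r=\mathtt{(?=}R^r\mathtt{)}$, $\mathtt{(?!}R\mathtt{)}^r=\mathtt{(?<!}R^r\mathtt{)}$, $\mathtt{(?<!}R\mathtt{)}^r=\mathtt{(?!}R^r\mathtt{)}$. **Nullability, derivatives, match end** (mutually recursive). For valid $x$: $\mathit{Null}_x(())$ is true; $\mathit{Null}_x(\psi)$ is false; $\mathit{Null}_x(R|R')$ iff $\mathit{Null}_x(R)$ or $\mathit{Null}_x(R')$; $\mathit{Null}_x(R\&R')$ iff $\mathit{Null}_x(R\cdot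 R')$ iff $\mathit{Null}_x(R)$ and $\mathit{Null}_x(R')$; $\mathit{Null}_x(R\{m,n\})$ iff $m=0$ or $\mathit{Null}_x(R)$; $\mathit{Null}_x(\sim R)$ iff not $\mathit{Null}_x(R)$; $\mathit{Null}_x(\mathtt{(?=}R\mathtt{)})$ iff $\mathit{IsMatch}(x,R)$; $\mathit{Null}_x(\mathtt{(?<=}R\mathtt{)})$ iff $\mathit{IsMatch}(x^r,R^r)$; $\mathit{Null}_x(\mathtt{(?!}R\mathtt{)})$ iff not $\mathit{IsMatch}(x,R)$; $\mathit{Null}_x(\mathtt{(?<!}R\mathtt{)})$ iff not $\mathit{IsMatch}(x^r,R^r)$. $\mathit{Null}_\forall(R)$ means that $\mathit{Null}_x(R)$ is true for all valid $x$ (in all strings). For valid nonfinal $x=s\langle i\rangle$ the derivative $\partial_x(R)\in\mathcal{R}$ is: $\partial_x(())=\bot$; $\partial_x(\ell)=\bot$ for lookarounds $\ell$; $\partial_{s\langle i\rangle}(\psi)=()$ if $s_i\in[\![\psi]\!]$, else $\bot$; $\partial_x(R|S)=\partial_x(R)|\partial_x(S)$; $\partial_x(R\&S)=\partial_x(R)\&\partial_x(S)$; $\partial_x(\sim R)=\sim\partial_x(R)$; $\partial_x(R\cdot S)=(\partial_x(R)\cdot S)\,|\,\partial_x(S)$ if $\mathit{Null}_x(R)$, else $\partial_x(R)\cdot S$; $\partial_x(R\{m,n\})=\partial_x(R)\cdot R\{m\dot-1,n\dot-1\}$ if $m=0$ or $\mathit{Null}_\forall(R)$ or not $\mathit{Null}_x(R)$,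 else $\partial_x(R\cdot R\{m\dot-1,n\dot-1\})$. Here $\infty\dot-1=\infty$, $0\dot-1=0$, $k\dot-1=k-1$ for $k>0$. $\mathit{Null}^{\mathsf{fail}}_x(R)=x$ if $\mathit{Null}_x(R)$, else $\mathsf{fail}$. $\mathit{MatchEnd}(x,R)=\mathit{Null}^{\mathsf{fail}}_x(R)$ if $x$ is final, else $\max(\mathit{Null}^{\mathsf{fail}}_x(R),\mathit{MatchEnd}(x+1,\partial_x(R)))$. $\mathit{IsMatch}(x,R)$ iff $\mathit{MatchEnd}(x,R)\ne\mathsf{fail}$. **Derivation relation.** For valid $x$, the set of all match ends is $(x\xrightarrow{R})=N_x(R)$ if $x$ is final, else $N_x(R)\cup(x+1\xrightarrow{\partial_x(R)})$, where $N_x(R)=\{x\}$ if $\mathit{Null}_x(R)$ and $\emptyset$ otherwise. Write $x\xrightarrow{R}y$ iff $y\in(x\xrightarrow{R})$. *)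

theory Defs
  imports Main "HOL-Library.Extended_Nat"
begin

section \<open>Effective Boolean algebras\<close>

text \<open>The type \<open>'a\<close> is the domain of characters and the type \<open>'p\<close> is the set of predicates, which
  is thereby closed under the connectives.\<close>

record ('p, 'a) boolean_alg =
  denote :: "'p \<Rightarrow> 'a set"
  pbot :: 'p
  ptop :: 'p
  pdisj :: "'p \<Rightarrow> 'p \<Rightarrow> 'p"
  pconj :: "'p \<Rightarrow> 'p \<Rightarrow> 'p"
  pneg :: "'p \<Rightarrow> 'p"

locale effective_boolean_algebra =
  fixes A :: "('p, 'a) boolean_alg"
  assumes denote_bot: "denote A (pbot A) = {}"
    and denote_top: "denote A (ptop A) = UNIV"
    and denote_disj: "denote A (pdisj A \<phi> \<psi>) = denote A \<phi> \<union> denote A \<psi>"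
    and denote_conj: "denote A (pconj A \<phi> \<psi>) = denote A \<phi> \<inter> denote A \<psi>"
    and denote_neg: "denote A (pneg A \<phi>) = UNIV - denote A \<phi>"


section \<open>Locations\<close>

text \<open>Positions are integers because the match failure has position \<open>-1\<close>.\<close>

type_synonym 'a loc = "'a list \<times> int"

definition valid :: "'a loc \<Rightarrow> bool" where
  "valid x \<longleftrightarrow> 0 \<le> snd x \<and> snd x \<le> int (length (fst x))"

definition final :: "'a loc \<Rightarrow> bool" where
  "final x \<longleftrightarrow> snd x = int (length (fst x))"

definition loc_next :: "'a loc \<Rightarrow> 'a loc" where
  "loc_next x = (fst x, snd x + 1)"

definition loc_rev :: "'a loc \<Rightarrow> 'a loc" where
  "loc_rev x = (rev (fst x), int (length (fst x)) - snd x)"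

definition fail :: "'a loc" where
  "fail = ([], -1)"

text \<open>Locations are compared by position; \<^const>\<open>fail\<close> is neutral. Two arguments different from
  \<^const>\<open>fail\<close> are only ever compared within one string.\<close>

definition loc_max :: "'a loc \<Rightarrow> 'a loc \<Rightarrow> 'a loc" where
  "loc_max x y =
    (if x = fail then y else if y = fail then x else if snd x < snd y then y else x)"

text \<open>The character at a location satisfies a predicate. At positions \<open>-1\<close> and \<open>length s\<close> the
  character is the empty string, which satisfies no predicate.\<close>

definition char_sat :: "('p, 'a) boolean_alg \<Rightarrow> 'a loc \<Rightarrow> 'p \<Rightarrow> bool" where
  "char_sat A x \<psi> \<longleftrightarrow>
    0 \<le> snd x \<and> snd x < int (length (fst x)) \<and> fst x ! nat (snd x) \<in> denote A \<psi>"


section \<open>Regexes\<close>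

datatype 'p regex =
    Pred 'p
  | Empty
  | Alt "'p regex" "'p regex"
  | And "'p regex" "'p regex"
  | Cat "'p regex" "'p regex"
  | Loop "'p regex" nat enat
  | Compl "'p regex"
  | Lookahead "'p regex"
  | Lookback "'p regex"
  | NegLookahead "'p regex"
  | NegLookback "'p regex"

text \<open>The regexes of the grammar are the terms whose loop bounds satisfy the side condition. An
  infinite upper bound is \<open>\<infinity>\<close>.\<close>

fun wf_regex :: "'p regex \<Rightarrow> bool" where
  "wf_regex (Pred \<psi>) \<longleftrightarrow> True"
| "wf_regex Empty \<longleftrightarrow> True"
| "wf_regex (Alt R S) \<longleftrightarrow> wf_regex R \<and> wf_regex S"
| "wf_regex (And R S) \<longleftrightarrow> wf_regex R \<and> wf_regex S"
| "wf_regex (Cat R S) \<longleftrightarrow> wf_regex R \<and> wf_regex S"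
| "wf_regex (Loop R m n) \<longleftrightarrow> wf_regex R \<and> enat m \<le> n \<and> n \<noteq> 0"
| "wf_regex (Compl R) \<longleftrightarrow> wf_regex R"
| "wf_regex (Lookahead R) \<longleftrightarrow> wf_regex R"
| "wf_regex (Lookback R) \<longleftrightarrow> wf_regex R"
| "wf_regex (NegLookahead R) \<longleftrightarrow> wf_regex R"
| "wf_regex (NegLookback R) \<longleftrightarrow> wf_regex R"

text \<open>\<open>R{m,n}\<close> with the convention \<open>R{0,0} = ()\<close>. Decremented bounds can reach \<open>{0,0}\<close>.\<close>

definition loop :: "'p regex \<Rightarrow> nat \<Rightarrow> enat \<Rightarrow> 'p regex" where
  "loop R m n = (if m = 0 \<and> n = 0 then Empty else Loop R m n)"

fun regex_rev :: "'p regex \<Rightarrow> 'p regex" where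
  "regex_rev (Pred \<psi>) = Pred \<psi>"
| "regex_rev Empty = Empty"
| "regex_rev (Alt R S) = Alt (regex_rev R) (regex_rev S)"
| "regex_rev (And R S) = And (regex_rev R) (regex_rev S)"
| "regex_rev (Cat R S) = Cat (regex_rev S) (regex_rev R)"
| "regex_rev (Loop R m n) = Loop (regex_rev R) m n"
| "regex_rev (Compl R) = Compl (regex_rev R)"
| "regex_rev (Lookahead R) = Lookback (regex_rev R)"
| "regex_rev (Lookback R) = Lookahead (regex_rev R)"
| "regex_rev (NegLookahead R) = NegLookback (regex_rev R)"
| "regex_rev (NegLookback R) = NegLookahead (regex_rev R)"

lemma wf_regex_rev [simp]: "wf_regex (regex_rev R) \<longleftrightarrow> wf_regex R"
  by (induction R) auto


section \<open>Nullability, derivatives and match ends\<close>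

text \<open>Measures for the termination of the mutual recursion: the nesting depth of lookarounds, which
  derivatives do not increase, and a size that strictly decreases when a mandatory loop iteration is
  unfolded.\<close>

fun la_depth :: "'p regex \<Rightarrow> nat" where
  "la_depth (Pred \<psi>) = 0"
| "la_depth Empty = 0"
| "la_depth (Alt R S) = max (la_depth R) (la_depth S)"
| "la_depth (And R S) = max (la_depth R) (la_depth S)"
| "la_depth (Cat R S) = max (la_depth R) (la_depth S)"
| "la_depth (Loop R m n) = la_depth R"
| "la_depth (Compl R) = la_depth R"
| "la_depth (Lookahead R) = Suc (la_depth R)"
| "la_depth (Lookback R) = Suc (la_depth R)"
| "la_depth (NegLookahead R) = Suc (la_depth R)"
| "la_depth (NegLookback R) = Suc (la_depth R)"

fun weight :: "'p regex \<Rightarrow> nat" where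
  "weight (Pred \<psi>) = 1"
| "weight Empty = 1"
| "weight (Alt R S) = weight R + weight S + 1"
| "weight (And R S) = weight R + weight S + 1"
| "weight (Cat R S) = weight R + weight S + 1"
| "weight (Loop R m n) = (weight R + 3) * (m + 1)"
| "weight (Compl R) = weight R + 1"
| "weight (Lookahead R) = 1"
| "weight (Lookback R) = 1"
| "weight (NegLookahead R) = 1"
| "weight (NegLookback R) = 1"

lemma la_depth_rev [simp]: "la_depth (regex_rev R) = la_depth R"
  by (induction R) auto

lemma la_depth_loop: "la_depth (loop R m n) \<le> la_depth R"
  by (simp add: loop_def)

lemma weight_loop: "0 < m \<Longrightarrow> weight (Cat R (loop R (m - 1) n)) < weight (Loop R m n')"
  by (cases m) (auto simp: loop_def)

lemma all_fundef_cong [fundef_cong]: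
  "(\<And>x. P x = Q x) \<Longrightarrow> (\<forall>x. P x) = (\<forall>x. Q x)"
  by simp

text \<open>Only the values at valid locations (for \<open>der\<close>: valid nonfinal ones) are meaningful; elsewhere
  the functions are total by convention, and \<open>match_end\<close> does not advance.\<close>

function
    null :: "('p, 'a) boolean_alg \<Rightarrow> 'a loc \<Rightarrow> 'p regex \<Rightarrow> bool"
  and null_all :: "('p, 'a) boolean_alg \<Rightarrow> 'p regex \<Rightarrow> bool"
  and der :: "('p, 'a) boolean_alg \<Rightarrow> 'a loc \<Rightarrow> 'p regex \<Rightarrow> 'p regex"
  and null_fail :: "('p, 'a) boolean_alg \<Rightarrow> 'a loc \<Rightarrow> 'p regex \<Rightarrow> 'a loc"
  and match_end :: "('p, 'a) boolean_alg \<Rightarrow> 'a loc \<Rightarrow> 'p regex \<Rightarrow> 'a loc"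
  and is_match :: "('p, 'a) boolean_alg \<Rightarrow> 'a loc \<Rightarrow> 'p regex \<Rightarrow> bool"
where
  "null A x (Pred \<psi>) \<longleftrightarrow> False"
| "null A x Empty \<longleftrightarrow> True"
| "null A x (Alt R S) \<longleftrightarrow> null A x R \<or> null A x S"
| "null A x (And R S) \<longleftrightarrow> null A x R \<and> null A x S"
| "null A x (Cat R S) \<longleftrightarrow> null A x R \<and> null A x S"
| "null A x (Loop R m n) \<longleftrightarrow> m = 0 \<or> null A x R"
| "null A x (Compl R) \<longleftrightarrow> \<not> null A x R"
| "null A x (Lookahead R) \<longleftrightarrow> is_match A x R"
| "null A x (Lookback R) \<longleftrightarrow> is_match A (loc_rev x) (regex_rev R)"
| "null A x (NegLookahead R) \<longleftrightarrow> \<not> is_match A x R"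
| "null A x (NegLookback R) \<longleftrightarrow> \<not> is_match A (loc_rev x) (regex_rev R)"

| "null_all A R \<longleftrightarrow> (\<forall>x. valid x \<longrightarrow> null A x R)"

| "der A x (Pred \<psi>) = (if char_sat A x \<psi> then Empty else Pred (pbot A))"
| "der A x Empty = Pred (pbot A)"
| "der A x (Alt R S) = Alt (der A x R) (der A x S)"
| "der A x (And R S) = And (der A x R) (der A x S)"
| "der A x (Cat R S) =
    (if null A x R then Alt (Cat (der A x R) S) (der A x S) else Cat (der A x R) S)"
| "der A x (Loop R m n) =
    (if m = 0 \<or> null_all A R \<or> \<not> null A x R
     then Cat (der A x R) (loop R (m - 1) (n - 1))
     else der A x (Cat R (loop R (m - 1) (n - 1))))"
| "der A x (Compl R) = Compl (der A x R)"
| "der A x (Lookahead R) = Pred (pbot A)"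
| "der A x (Lookback R) = Pred (pbot A)"
| "der A x (NegLookahead R) = Pred (pbot A)"
| "der A x (NegLookback R) = Pred (pbot A)"

| "null_fail A x R = (if null A x R then x else fail)"

| "match_end A x R =
    (if valid x \<and> \<not> final x
     then loc_max (null_fail A x R) (match_end A (loc_next x) (der A x R))
     else null_fail A x R)"

| "is_match A x R \<longleftrightarrow> match_end A x R \<noteq> fail"
  by pat_completeness auto

lemma la_depth_der_dom:
  assumes "null_null_all_der_null_fail_match_end_is_match_dom (Inl (Inr (Inr (A, x, R))))"
  shows "la_depth (der A x R) \<le> la_depth R"
  using assms
proof (induction rule: null_null_all_der_null_fail_match_end_is_match.pinduct(3)
    [where ?P1.0 = "\<lambda>_ _ _. True" and ?P2.0 = "\<lambda>_ _. True" and ?P4.0 = "\<lambda>_ _ _. True"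
      and ?P5.0 = "\<lambda>_ _ _. True" and ?P6.0 = "\<lambda>_ _ _. True"])
qed (auto simp: der.psimps loop_def)

termination
proof (relation "inv_image (less_than <*lex*> less_than <*lex*> less_than <*lex*> less_than)
    (case_sum
      (case_sum
        (\<lambda>(A, x, R). (la_depth R, 0, weight R, 0))
        (case_sum
          (\<lambda>(A, R). (la_depth R, 0, weight R, 1))
          (\<lambda>(A, x, R). (la_depth R, 0, weight R, 1))))
      (case_sum
        (\<lambda>(A, x, R). (la_depth R, 1, 0, 0))
        (case_sum
          (\<lambda>(A, x, R). (la_depth R, 2, nat (int (length (fst x)) - snd x), 0))
          (\<lambda>(A, x, R). (la_depth R, 3, 0, 0)))))", goal_cases)
  case 1
  show ?case by auto
qed (use weight_loop in \<open>auto simp: valid_def final_def loc_next_def loop_def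
    dest!: la_depth_der_dom split: if_splits\<close>)

declare match_end.simps [simp del]

lemma wf_regex_loop_dec:
  assumes "wf_regex (Loop R m n)"
  shows "wf_regex (loop R (m - 1) (n - 1))"
proof (cases n)
  case (enat k)
  then show ?thesis using assms
    by (auto simp: loop_def one_enat_def zero_enat_def)
qed (use assms in \<open>auto simp: loop_def\<close>)

lemma wf_regex_der: "wf_regex R \<Longrightarrow> wf_regex (der A x R)"
proof (induction A x R rule: null_null_all_der_null_fail_match_end_is_match.induct(3)
    [where ?P1.0 = "\<lambda>_ _ _. True" and ?P2.0 = "\<lambda>_ _. True" and ?P4.0 = "\<lambda>_ _ _. True"
      and ?P5.0 = "\<lambda>_ _ _. True" and ?P6.0 = "\<lambda>_ _ _. True"])
  case (18 A x R m n)
  then show ?case using wf_regex_loop_dec[of R m n] by (auto simp del: null_all.simps)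
qed auto


section \<open>The derivation relation\<close>

function match_ends :: "('p, 'a) boolean_alg \<Rightarrow> 'a loc \<Rightarrow> 'p regex \<Rightarrow> 'a loc set" where
  "match_ends A x R =
    (if valid x \<and> \<not> final x
     then (if null A x R then {x} else {}) \<union> match_ends A (loc_next x) (der A x R)
     else (if null A x R then {x} else {}))"
  by pat_completeness auto
termination
  by (relation "measure (\<lambda>(A, x, R). nat (int (length (fst x)) - snd x))")
    (auto simp: valid_def final_def loc_next_def)

declare match_ends.simps [simp del]

definition derives :: "('p, 'a) boolean_alg \<Rightarrow> 'a loc \<Rightarrow> 'p regex \<Rightarrow> 'a loc \<Rightarrow> bool" where
  "derives A x R y \<longleftrightarrow> y \<in> match_ends A x R"

end

theory Submission
  imports Defs
begin

text \<open>On a fixed string \<open>s\<close> the derivation relation has a compositional description by sets of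
  pairs of positions: concatenation is relational composition, a loop is a union of powers, and
  complement is taken within the pairs \<open>i \<le> j\<close>. In this description reversal just mirrors the
  pairs, provided that it preserves nullability of lookarounds. The latter needs no induction through
  the lookarounds, since a lookback is by definition a lookahead in the reversed string and reversal
  is an involution.\<close>

section \<open>Reversal and nullability\<close>

lemma regex_rev_regex_rev [simp]: "regex_rev (regex_rev R) = R"
  by (induction R) auto

lemma loc_rev_loc_rev [simp]: "loc_rev (loc_rev x) = x"
  by (simp add: loc_rev_def)

lemma null_rev: "null A (loc_rev x) (regex_rev R) \<longleftrightarrow> null A x R"
  by (induction R) (auto simp del: is_match.simps)

section \<open>Relational semantics on positions\<close>

text \<open>Lookarounds take \<open>null\<close> as an oracle, so the recursion stops at them. The
  validity conjunct for \<open>Loop\<close> restricts the power 0, which is the identity on all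
  integers.\<close>

primrec sem :: "('p, 'a) boolean_alg \<Rightarrow> 'a list \<Rightarrow> 'p regex \<Rightarrow> (int \<times> int) set" where
  "sem A s (Pred \<psi>) = {(i, j). j = i + 1 \<and> char_sat A (s, i) \<psi>}"
| "sem A s Empty = {(i, j). i = j \<and> valid (s, i)}"
| "sem A s (Alt R S) = sem A s R \<union> sem A s S"
| "sem A s (And R S) = sem A s R \<inter> sem A s S"
| "sem A s (Cat R S) = sem A s R O sem A s S"
| "sem A s (Loop R m n) =
    {(i, j). valid (s, i) \<and> (\<exists>k\<ge>m. enat k \<le> n \<and> (i, j) \<in> sem A s R ^^ k)}"
| "sem A s (Compl R) = {(i, j). i \<le> j \<and> valid (s, i) \<and> valid (s, j)} - sem A s R"
| "sem A s (Lookahead R) = {(i, j). i = j \<and> valid (s, i) \<and> null A (s, i) (Lookahead R)}"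
| "sem A s (Lookback R) = {(i, j). i = j \<and> valid (s, i) \<and> null A (s, i) (Lookback R)}"
| "sem A s (NegLookahead R) = {(i, j). i = j \<and> valid (s, i) \<and> null A (s, i) (NegLookahead R)}"
| "sem A s (NegLookback R) = {(i, j). i = j \<and> valid (s, i) \<and> null A (s, i) (NegLookback R)}"

text \<open>Carries position bounds from one loop iteration to all powers; \<open>P i\<close> is
  assumed because the power 0 makes no step.\<close>

lemma relpow_invariant:
  assumes "(i, j) \<in> r ^^ k" "P i" "\<And>a b. (a, b) \<in> r \<Longrightarrow> P b \<and> a \<le> b"
  shows "P j \<and> i \<le> (j :: int)"
  using assms(1)
proof (induction k arbitrary: j)
  case 0
  then show ?case using assms(2) by simp
next
  case (Suc k)
  then obtain l where "(i, l) \<in> r ^^ k" "(l, j) \<in> r" by auto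
  with Suc.IH[of l] assms(3)[of l j] show ?case by auto
qed

lemma sem_bounds: "(i, j) \<in> sem A s R \<Longrightarrow> i \<le> j \<and> valid (s, i) \<and> valid (s, j)"
proof (induction R arbitrary: i j)
  case (Cat R S)
  then show ?case by fastforce
next
  case (Loop R m n)
  from Loop.prems obtain k where "(i, j) \<in> sem A s R ^^ k" "valid (s, i)" by auto
  with relpow_invariant[of i j k "sem A s R" "\<lambda>i. valid (s, i)"] Loop.IH
  show ?case by blast
qed (auto simp: char_sat_def valid_def)

lemma relpow_refl:
  assumes "(i, i) \<in> r"
  shows "(i, i) \<in> r ^^ k"
  using assms by (induction k) auto

text \<open>Positions never decrease along a match, so every factor of an empty match is itself
  empty and sits at \<open>i\<close>.\<close>

lemma sem_null:
  assumes "wf_regex R" "valid (s, i)"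
  shows "(i, i) \<in> sem A s R \<longleftrightarrow> null A (s, i) R"
  using assms(1)
proof (induction R)
  case (Cat R S)
  have "(i, i) \<in> sem A s (Cat R S) \<longleftrightarrow> (i, i) \<in> sem A s R \<and> (i, i) \<in> sem A s S"
  proof
    assume "(i, i) \<in> sem A s (Cat R S)"
    then obtain l where l: "(i, l) \<in> sem A s R" "(l, i) \<in> sem A s S" by auto
    with sem_bounds[OF l(1)] sem_bounds[OF l(2)] have "l = i" by simp
    with l show "(i, i) \<in> sem A s R \<and> (i, i) \<in> sem A s S" by simp
  qed auto
  with Cat show ?case by simp
next
  case (Loop R m n)
  have "(i, i) \<in> sem A s R" if "(i, i) \<in> sem A s R ^^ k" "k \<noteq> 0" for k
  proof -
    from that obtain k' where "(i, i) \<in> sem A s R ^^ Suc k'" by (cases k) auto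
    then obtain l where l: "(i, l) \<in> sem A s R ^^ k'" "(l, i) \<in> sem A s R" by auto
    have "i \<le> l"
      using relpow_invariant[OF l(1), of "\<lambda>_. True"] sem_bounds by blast
    with sem_bounds[OF l(2)] have "l = i" by simp
    with l show ?thesis by simp
  qed
  moreover have "enat 0 \<le> n" by (simp add: zero_enat_def[symmetric])
  \<comment> \<open>The exponent is 0 if \<open>m = 0\<close>, and otherwise \<open>m\<close>, with
    every iteration idle at \<open>i\<close>.\<close>
  ultimately have "(i, i) \<in> sem A s (Loop R m n) \<longleftrightarrow> m = 0 \<or> (i, i) \<in> sem A s R"
    using Loop.prems assms(2) relpow_refl[of i "sem A s R" m] by (auto intro: exI[of _ 0] exI[of _ m])
  with Loop show ?case by simp
qed (use assms(2) in \<open>auto simp: char_sat_def simp del: is_match.simps\<close>)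

section \<open>Loops\<close>

lemma sem_loop [simp]: "sem A s (loop R m n) = sem A s (Loop R m n)"
  by (auto simp: loop_def zero_enat_def valid_def)

text \<open>\<open>n = 0\<close> is excluded because subtraction truncates: \<open>0 - 1 = 0\<close>
  would admit \<open>k = 0\<close> on the right only.\<close>

lemma enat_Suc_le_iff: "n \<noteq> 0 \<Longrightarrow> enat (Suc k) \<le> n \<longleftrightarrow> enat k \<le> n - 1"
  by (cases n) (auto simp: one_enat_def zero_enat_def)

text \<open>Splits off the first iteration, which exists as \<open>m > 0\<close>. This matches the
  clause of \<open>der\<close> that defers to a concatenation.\<close>

lemma sem_Loop_unfold:
  assumes "0 < m" "n \<noteq> 0"
  shows "sem A s (Loop R m n) = sem A s (Cat R (loop R (m - 1) (n - 1)))"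
proof (intro set_eqI iffI; clarify)
  fix i j
  assume "(i, j) \<in> sem A s (Loop R m n)"
  then obtain k where k: "m \<le> k" "enat k \<le> n" "(i, j) \<in> sem A s R ^^ k" by auto
  with assms obtain k' where k': "k = Suc k'" by (cases k) auto
  with k obtain l where l: "(i, l) \<in> sem A s R" "(l, j) \<in> sem A s R ^^ k'"
    by (metis relpow_Suc_D2)
  from k k' assms have "m - 1 \<le> k'" "enat k' \<le> n - 1"
    using enat_Suc_le_iff[of n k'] by auto
  with l sem_bounds[OF l(1)] show "(i, j) \<in> sem A s (Cat R (loop R (m - 1) (n - 1)))"
    by auto
next
  fix i j
  assume "(i, j) \<in> sem A s (Cat R (loop R (m - 1) (n - 1)))"
  then obtain l k where l: "(i, l) \<in> sem A s R" "(l, j) \<in> sem A s R ^^ k"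
    "m - 1 \<le> k" "enat k \<le> n - 1" by auto
  then have "(i, j) \<in> sem A s R ^^ Suc k" by (metis relpow_Suc_I2)
  moreover have "enat (Suc k) \<le> n" "m \<le> Suc k"
    using l assms enat_Suc_le_iff[of n k] by auto
  ultimately show "(i, j) \<in> sem A s (Loop R m n)"
    using sem_bounds[OF l(1)] by (auto simp del: relpow.simps)
qed

text \<open>Skip the idle steps at \<open>i\<close> up to the first step that leaves
  \<open>i\<close>. The last conclusion records that either an idle step exists or only the leaving
  step was removed.\<close>

lemma relpow_proper_step:
  assumes "(i, j) \<in> r ^^ k" "i \<noteq> j"
  obtains l k' where "k' < k" "l \<noteq> i" "(i, l) \<in> r" "(l, j) \<in> r ^^ k'"
    "(i, i) \<in> r \<or> k = Suc k'"
  using assms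
proof (induction k arbitrary: thesis)
  case 0
  then show ?case by simp
next
  case (Suc k)
  from Suc.prems(2) obtain l where l: "(i, l) \<in> r" "(l, j) \<in> r ^^ k"
    by (metis relpow_Suc_D2)
  show ?case
  proof (cases "l = i")
    case True
    with l Suc.IH Suc.prems(1,3) show ?thesis by (metis less_SucI)
  next
    case False
    with l Suc.prems(1) show ?thesis by blast
  qed
qed

lemma relpow_pad:
  assumes "(i, j) \<in> r ^^ k" "(i, i) \<in> r" "k \<le> k'"
  shows "(i, j) \<in> r ^^ k'"
  using assms(3)
proof (induction k' rule: dec_induct)
  case base
  then show ?case using assms(1) .
next
  case (step k')
  with assms(2) show ?case by (metis relpow_Suc_I2)
qed

text \<open>Skipping idle iterations may leave fewer than \<open>m - 1\<close>. Each alternative of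
  \<open>nl\<close> repairs this: no lower bound is left, the lost iterations can be repeated idly
  at \<open>l\<close>, or none was idle at \<open>i\<close>.\<close>

lemma sem_Loop_proper_step:
  assumes wf: "wf_regex (Loop R m n)" and "i < j"
    and nl: "m = 0 \<or> null_all A R \<or> \<not> null A (s, i) R"
  shows "(i, j) \<in> sem A s (Loop R m n) \<longleftrightarrow>
    (\<exists>l>i. (i, l) \<in> sem A s R \<and> (l, j) \<in> sem A s (Loop R (m - 1) (n - 1)))"
proof
  assume "(i, j) \<in> sem A s (Loop R m n)"
  then obtain k where k: "m \<le> k" "enat k \<le> n" "(i, j) \<in> sem A s R ^^ k" and v: "valid (s, i)"
    by auto
  from relpow_proper_step[OF k(3)] \<open>i < j\<close> obtain l k' where
    l: "k' < k" "l \<noteq> i" "(i, l) \<in> sem A s R" "(l, j) \<in> sem A s R ^^ k'"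
    and first: "(i, i) \<in> sem A s R \<or> k = Suc k'"
    by blast
  have b: "i \<le> l" "valid (s, l)" using sem_bounds[OF l(3)] by auto
  \<comment> \<open>\<open>q < k\<close> preserves the upper bound: with the step to
    \<open>l\<close> added, the count still does not exceed \<open>n\<close>.\<close>
  have "\<exists>q\<ge>m - 1. q < k \<and> (l, j) \<in> sem A s R ^^ q"
    using nl
  proof (elim disjE)
    assume "m = 0"
    with l show ?thesis by auto
  next
    assume "null_all A R"
    \<comment> \<open>The padding happens at \<open>l\<close>, not at \<open>i\<close>, so
      nullability at \<open>i\<close> alone would not suffice.\<close>
    then have "(l, l) \<in> sem A s R" using sem_null[of R s l A] wf b by simp
    then have "(l, j) \<in> sem A s R ^^ (k - 1)" using relpow_pad[OF l(4)] l(1) by simp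
    with k(1) l(1) show ?thesis by (intro exI[of _ "k - 1"]) auto
  next
    assume "\<not> null A (s, i) R"
    then have "k = Suc k'" using first sem_null[of R s i A] wf v by simp
    with k(1) l show ?thesis by (intro exI[of _ k']) auto
  qed
  then obtain q where q: "q \<ge> m - 1" "q < k" "(l, j) \<in> sem A s R ^^ q" by blast
  have "enat (Suc q) \<le> n" using q(2) k(2) by (metis Suc_leI enat_ord_simps(1) order_trans)
  then have "enat q \<le> n - 1" using enat_Suc_le_iff wf by simp
  with q b l show "\<exists>l>i. (i, l) \<in> sem A s R \<and> (l, j) \<in> sem A s (Loop R (m - 1) (n - 1))"
    by (intro exI[of _ l]) auto
next
  assume "\<exists>l>i. (i, l) \<in> sem A s R \<and> (l, j) \<in> sem A s (Loop R (m - 1) (n - 1))"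
  then obtain l k where l: "(i, l) \<in> sem A s R" "(l, j) \<in> sem A s R ^^ k"
    "m - 1 \<le> k" "enat k \<le> n - 1" by auto
  then have "(i, j) \<in> sem A s R ^^ Suc k" by (metis relpow_Suc_I2)
  moreover have "enat (Suc k) \<le> n" "m \<le> Suc k"
    using l wf enat_Suc_le_iff[of n k] by auto
  ultimately show "(i, j) \<in> sem A s (Loop R m n)"
    using sem_bounds[OF l(1)] by (auto simp del: relpow.simps)
qed

section \<open>Derivatives and the derivation relation\<close>

text \<open>Induction is on \<open>weight\<close>, since the derivative of a loop may pass to a
  concatenation that is not a subterm. \<open>i < j\<close> leaves out the empty matches, which a
  derivative forgets.\<close>

lemma sem_der:
  assumes "effective_boolean_algebra A" "wf_regex R" "0 \<le> i" "i < j"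
  shows "(i + 1, j) \<in> sem A s (der A (s, i) R) \<longleftrightarrow> (i, j) \<in> sem A s R"
  using assms(2,4)
proof (induction R arbitrary: j rule: measure_induct_rule[of weight])
  case (less R)
  have bot: "sem A s (Pred (pbot A)) = {}"
    using effective_boolean_algebra.denote_bot[OF assms(1)] by (auto simp: char_sat_def)
  show ?case
  proof (cases R)
    case (Pred \<psi>)
    with bot show ?thesis by (auto simp: char_sat_def valid_def)
  next
    case (Alt S T)
    with less show ?thesis by auto
  next
    case (And S T)
    with less show ?thesis by auto
  next
    case (Compl S)
    then have "(i, j) \<in> sem A s S \<longleftrightarrow> (i + 1, j) \<in> sem A s (der A (s, i) S)"
      using less by simp
    \<comment> \<open>Both pairs lie in the carrier of the complement under the same condition,
      namely that \<open>j\<close> is valid.\<close>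
    with Compl less.prems(2) assms(3) show ?thesis by (auto simp: valid_def)
  next
    case (Cat S T)
    then have IH: "(i + 1, l) \<in> sem A s (der A (s, i) S) \<longleftrightarrow> (i, l) \<in> sem A s S"
      "(i + 1, l) \<in> sem A s (der A (s, i) T) \<longleftrightarrow> (i, l) \<in> sem A s T" if "i < l" for l
      using less.IH[of S l] less.IH[of T l] less.prems that by auto
    have null: "(i, i) \<in> sem A s S \<longleftrightarrow> valid (s, i) \<and> null A (s, i) S"
      using sem_null[of S s i A] sem_bounds[of i i A s S] less.prems Cat by auto
    \<comment> \<open>Frees the induction hypothesis from \<open>i < l\<close>: no
      \<open>l \<le> i\<close> is reachable from \<open>i + 1\<close>.\<close>
    have step: "(i + 1, l) \<in> sem A s (der A (s, i) S) \<longleftrightarrow> i < l \<and> (i, l) \<in> sem A s S" for l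
      using IH(1)[of l] sem_bounds[of "i + 1" l A s "der A (s, i) S"] by auto
    \<comment> \<open>The part matched by \<open>S\<close> is empty or not; these cases become the
      two summands of the derivative.\<close>
    have "(i, j) \<in> sem A s R \<longleftrightarrow> ((i, i) \<in> sem A s S \<and> (i, j) \<in> sem A s T) \<or>
        (\<exists>l>i. (i, l) \<in> sem A s S \<and> (l, j) \<in> sem A s T)"
      using Cat sem_bounds by (fastforce simp: order.order_iff_strict)
    also have "\<dots> \<longleftrightarrow> (null A (s, i) S \<and> (i, j) \<in> sem A s T) \<or>
        (\<exists>l>i. (i, l) \<in> sem A s S \<and> (l, j) \<in> sem A s T)"
      using null sem_bounds by blast
    also have "(\<exists>l>i. (i, l) \<in> sem A s S \<and> (l, j) \<in> sem A s T) \<longleftrightarrow>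
        (i + 1, j) \<in> sem A s (Cat (der A (s, i) S) T)"
      using step by (simp add: relcomp_unfold)
    finally show ?thesis using Cat IH(2)[OF less.prems(2)] by auto
  next
    case (Loop S m n)
    show ?thesis
    proof (cases "m = 0 \<or> null_all A S \<or> \<not> null A (s, i) S")
      case True
      have step: "(i + 1, l) \<in> sem A s (der A (s, i) S) \<longleftrightarrow> i < l \<and> (i, l) \<in> sem A s S" for l
        using less.IH[of S l] sem_bounds[of "i + 1" l A s "der A (s, i) S"] less.prems Loop by auto
      have "(i, j) \<in> sem A s R \<longleftrightarrow>
          (\<exists>l>i. (i, l) \<in> sem A s S \<and> (l, j) \<in> sem A s (Loop S (m - 1) (n - 1)))"
        using sem_Loop_proper_step[of S m n i j A s] less.prems True Loop by blast
      also have "\<dots> \<longleftrightarrow> (i + 1, j) \<in> sem A s (der A (s, i) S) O sem A s (Loop S (m - 1) (n - 1))"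
        by (simp only: relcomp_unfold mem_Collect_eq prod.case step conj_assoc)
      finally show ?thesis using Loop True by (simp del: null_all.simps sem.simps(6))
    next
      case False
      \<comment> \<open>Here \<open>m > 0\<close> and \<open>S\<close> is nullable at
        \<open>i\<close> but not everywhere, so the derivative is by definition that of
        \<open>?C\<close>.\<close>
      let ?C = "Cat S (loop S (m - 1) (n - 1))"
      have "weight ?C < weight R" using weight_loop[of m S "n - 1" n] False Loop by (simp del: weight.simps)
      moreover have "wf_regex ?C" using less.prems Loop wf_regex_loop_dec[of S m n] by simp
      ultimately have "(i + 1, j) \<in> sem A s (der A (s, i) ?C) \<longleftrightarrow> (i, j) \<in> sem A s ?C"
        using less.IH less.prems(2) by blast
      then show ?thesis
        using sem_Loop_unfold[of m n A s S] False Loop less.prems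
        by (simp del: null_all.simps sem.simps der.simps(5) add: der.simps(6))
    qed
  \<comment> \<open>\<open>Empty\<close> and the lookarounds relate no \<open>i < j\<close>, and
    their derivative \<open>Pred (pbot A)\<close> relates nothing.\<close>
  qed (use bot less.prems in auto)
qed

text \<open>Induction on the remaining length: the empty match is nullability at \<open>i\<close>,
  and a longer one continues from \<open>i + 1\<close> by \<open>sem_der\<close>.\<close>

lemma derives_iff_sem:
  assumes "effective_boolean_algebra A" "wf_regex R" "valid (s, i)"
  shows "derives A (s, i) R (t, j) \<longleftrightarrow> t = s \<and> (i, j) \<in> sem A s R"
  using assms(2,3)
proof (induction "nat (int (length s) - i)" arbitrary: i R rule: less_induct)
  case less
  have null: "(i, i) \<in> sem A s R \<longleftrightarrow> null A (s, i) R"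
    using sem_null less.prems by blast
  show ?case
  proof (cases "i < int (length s)")
    case True
    then have nf: "\<not> final (s, i)" "valid (s, i + 1)"
      using less.prems by (auto simp: final_def valid_def)
    have "derives A (s, i + 1) (der A (s, i) R) (t, j) \<longleftrightarrow>
        t = s \<and> (i + 1, j) \<in> sem A s (der A (s, i) R)"
      using less.hyps[of "i + 1" "der A (s, i) R"] True nf less.prems wf_regex_der by auto
    also have "\<dots> \<longleftrightarrow> t = s \<and> i < j \<and> (i, j) \<in> sem A s R"
      using sem_der[OF assms(1) less.prems(1), of i j s] less.prems(2)
        sem_bounds[of "i + 1" j A s "der A (s, i) R"] by (auto simp: valid_def)
    finally show ?thesis
      using null nf less.prems sem_bounds[of i j A s R]
      by (auto simp: derives_def match_ends.simps[of A "(s, i)"] loc_next_def)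
  next
    case False
    then have "final (s, i)" using less.prems by (auto simp: final_def valid_def)
    moreover have "(i, j) \<in> sem A s R \<Longrightarrow> i = j"
      using sem_bounds[of i j A s R] False by (auto simp: valid_def)
    ultimately show ?thesis
      using null by (auto simp: derives_def match_ends.simps[of A "(s, i)"])
  qed
qed

section \<open>Mirroring and reversal\<close>

text \<open>The converse relation after the change of positions from \<open>i\<close> to
  \<open>L - i\<close>: with \<open>L\<close> the string length, reversal also exchanges start and
  end.\<close>

definition mirror :: "int \<Rightarrow> (int \<times> int) set \<Rightarrow> (int \<times> int) set" where
  "mirror L r = {(i, j). (L - j, L - i) \<in> r}"

lemma mirror_iff [simp]: "(i, j) \<in> mirror L r \<longleftrightarrow> (L - j, L - i) \<in> r"
  by (simp add: mirror_def)

lemma mirror_diagonal: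
  assumes "\<And>i. P i \<longleftrightarrow> Q (L - i)"
  shows "{(i, j). i = j \<and> P i} = mirror L {(i, j). i = j \<and> Q i}"
  using assms by (auto simp: mirror_def)

lemma mirror_relcomp: "mirror L (r O q) = mirror L q O mirror L r"
proof (intro set_eqI iffI; clarify)
  fix i j assume "(i, j) \<in> mirror L (r O q)"
  then obtain l where "(L - j, l) \<in> r" "(l, L - i) \<in> q" by auto
  then show "(i, j) \<in> mirror L q O mirror L r" by (intro relcompI[of _ "L - l"]) auto
qed auto

text \<open>\<open>mirror_relcomp\<close> reverses the order of factors, which is harmless because a
  relation commutes with its powers.\<close>

lemma mirror_relpow: "mirror L (r ^^ k) = mirror L r ^^ k"
proof (induction k)
  case 0
  then show ?case by (auto simp: mirror_def)
next
  case (Suc k)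
  then show ?case by (simp add: mirror_relcomp relpow_commute)
qed

lemma valid_rev: "valid (rev s, i) \<longleftrightarrow> valid (s, int (length s) - i)"
  by (auto simp: valid_def)

lemma null_rev': "null A (rev s, i) (regex_rev R) \<longleftrightarrow> null A (s, int (length s) - i) R"
  using null_rev[of A "(s, int (length s) - i)" R] by (simp add: loc_rev_def)

lemma sem_rev: "sem A (rev s) (regex_rev R) = mirror (int (length s)) (sem A s R)"
proof (induction R)
  case (Pred \<psi>)
  \<comment> \<open>The position before a character in \<open>rev s\<close> corresponds to the one
    after it in \<open>s\<close>, hence the shift by one.\<close>
  have char: "char_sat A (rev s, i) \<psi> \<longleftrightarrow> char_sat A (s, int (length s) - (i + 1)) \<psi>" for i
    by (auto simp: char_sat_def rev_nth nat_diff_distrib' nat_less_iff Suc_nat_eq_nat_zadd1 add.commute)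
  show ?case
  proof (rule set_eqI, clarify)
    fix i j
    show "(i, j) \<in> sem A (rev s) (regex_rev (Pred \<psi>)) \<longleftrightarrow>
        (i, j) \<in> mirror (int (length s)) (sem A s (Pred \<psi>))"
      using char by (cases "j = i + 1") auto
  qed
next
  case (Loop R m n)
  \<comment> \<open>The loop clause asks for validity of the start only, which mirroring turns into
    the end; along a power the two are equivalent.\<close>
  have bound: "valid (s, i) \<longleftrightarrow> valid (s, j)" if "(i, j) \<in> sem A s R ^^ k" for i j k
    using that by (induction k arbitrary: j) (auto dest: sem_bounds)
  let ?L = "int (length s)"
  have pow: "(i, j) \<in> mirror ?L (sem A s R) ^^ k \<longleftrightarrow> (?L - j, ?L - i) \<in> sem A s R ^^ k" for i j k
    by (metis mirror_relpow mirror_iff)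
  show ?case
  proof (rule set_eqI, clarify)
    fix i j
    have "(i, j) \<in> sem A (rev s) (regex_rev (Loop R m n)) \<longleftrightarrow>
        valid (s, ?L - i) \<and> (\<exists>k\<ge>m. enat k \<le> n \<and> (?L - j, ?L - i) \<in> sem A s R ^^ k)"
      by (simp add: Loop valid_rev pow)
    also have "\<dots> \<longleftrightarrow>
        valid (s, ?L - j) \<and> (\<exists>k\<ge>m. enat k \<le> n \<and> (?L - j, ?L - i) \<in> sem A s R ^^ k)"
      using bound by blast
    finally show "(i, j) \<in> sem A (rev s) (regex_rev (Loop R m n)) \<longleftrightarrow>
        (i, j) \<in> mirror ?L (sem A s (Loop R m n))"
      by simp
  qed
next
  case (Lookahead R)
  \<comment> \<open>As for the other lookarounds, a diagonal mirrors to a diagonal and nullability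
    transfers by \<open>null_rev'\<close>.\<close>
  show ?case
    unfolding sem.simps regex_rev.simps using null_rev'[of A s _ "Lookahead R"]
    by (intro mirror_diagonal) (simp add: valid_rev del: null.simps)
next
  case (Lookback R)
  show ?case
    unfolding sem.simps regex_rev.simps using null_rev'[of A s _ "Lookback R"]
    by (intro mirror_diagonal) (simp add: valid_rev del: null.simps)
next
  case (NegLookahead R)
  show ?case
    unfolding sem.simps regex_rev.simps using null_rev'[of A s _ "NegLookahead R"]
    by (intro mirror_diagonal) (simp add: valid_rev del: null.simps)
next
  case (NegLookback R)
  show ?case
    unfolding sem.simps regex_rev.simps using null_rev'[of A s _ "NegLookback R"]
    by (intro mirror_diagonal) (simp add: valid_rev del: null.simps)
qed (auto simp: mirror_relcomp valid_rev)

theorem theorem2: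
  fixes A :: "('p, 'a) boolean_alg" and R :: "'p regex" and x y :: "'a loc"
  assumes "effective_boolean_algebra A"
    and "wf_regex R"
    and "valid x"
    and "valid y"
  shows "(null A x R \<longleftrightarrow> null A (loc_rev x) (regex_rev R)) \<and>
    (derives A x R y \<longleftrightarrow> derives A (loc_rev y) (regex_rev R) (loc_rev x))"
proof -
  obtain s i t j where xy: "x = (s, i)" "y = (t, j)" by (cases x, cases y)
  \<comment> \<open>The reversed derivation starts at the reverse of \<open>y\<close>, so
    \<open>derives_iff_sem\<close> needs that location valid. If \<open>s\<close> and
    \<open>t\<close> differ, both derivations fail.\<close>
  have "valid (rev t, int (length t) - j)"
    using assms(4) xy by (simp add: valid_rev)
  then have "derives A (loc_rev y) (regex_rev R) (loc_rev x) \<longleftrightarrow> derives A x R y"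
    using assms xy by (auto simp: loc_rev_def derives_iff_sem sem_rev)
  with null_rev show ?thesis by blast
qed

end
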